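(* Let $\alpha,\beta,\gamma\in[0,1]$ and let $p$ be the probability that a candidate accepts an offer. Consider the dynamic programming equation $$U(k)=\max\Big\{p\Big[(\alpha+\beta)\frac kN-\beta\Big]+(1-p)\Big[\sum_{j=k+1}^N\frac{k}{j(j-1)}U(j)-\gamma\frac kN\Big],\ \sum_{j=k+1}^N\frac{k}{j(j-1)}U(j)-\gamma\frac kN\Big\},$$ $k=1,2,\dots,N$, $U(N)=p(\alpha+\gamma)-\gamma$. Put $$t^\star=\Big(\frac{p\alpha+\beta-(1-p)\gamma}{\alpha+\beta}\Big)^{\frac1{1-p}},\qquad v(t)=\frac{\alpha p+\beta-(1-p)\gamma}{1-p}\,(t^p-t)+\beta t-\beta .$$ The asymptotic solution of this equation (as $N\to\infty$ with $k/N\to t\in(0,1]$) is $$u(t)=\begin{cases}p\,[(\alpha+\beta)t-\beta]+(1-p)\,[v(t)-\gamma t], & t\ge t^\star,\\ (\alpha+\beta)t^\star-\beta, & t<t^\star,\end{cases}$$ $$\phantom{u(t)}=\begin{cases}\dfrac{p(\alpha+\beta)+(1-p)(\beta-\gamma)}{1-p}\,(t^p-t)+(\beta-\gamma)t-\beta, & t\ge t^\star,\\ (\alpha+\beta)t^\star-\beta, & t<t^\star.\end{cases}$$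
   Context: Background: in the best choice problem with uncertain employment and penalties, $N$ distinct rankable applicants appear one by one in uniformly random order, and only relative ranks are observed; a candidate is an applicant better than all previous ones. A candidate who receives an offer accepts it with probability $p$ and refuses with probability $1-p$; after a refusal the search continues. Hiring the overall best applicant pays $\alpha$, hiring another one pays $-\beta$, and ending without hiring anyone pays $-\gamma$. $U(k)$ is the maximum expected payoff when the $k$-th applicant is a candidate and nobody has been hired before.
   Formalization: The second display for u(t) is false for t≥t* (α=1, β=γ=0, p=1/2, t=1: 0, not 1/2); the simplification proved is [pα+β−(1−p)γ]t^p−β, the printed one being the limit of the continuation value. t* is set to 0 if pα+β−(1−p)γ≤0, and p<1. *)

theory Defs
  imports Complex_Main
begin

text \<open>Second branch of the maximum in the dynamic programming equation: the expected payoff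
  when the search goes on after a candidate in position \<open>k\<close>. The summand
  \<open>k / (j (j - 1))\<close> is the probability that the next candidate after \<open>k\<close> is in position \<open>j\<close>, and
  \<open>k / N\<close> is the probability that there is none.\<close>
definition continuation :: "real \<Rightarrow> nat \<Rightarrow> (nat \<Rightarrow> real) \<Rightarrow> nat \<Rightarrow> real" where
  "continuation \<gamma> N U k =
     (\<Sum>j=k+1..N. real k / (real j * (real j - 1)) * U j) - \<gamma> * (real k / real N)"

definition dp_solution ::
    "real \<Rightarrow> real \<Rightarrow> real \<Rightarrow> real \<Rightarrow> nat \<Rightarrow> (nat \<Rightarrow> real) \<Rightarrow> bool" where
  "dp_solution \<alpha> \<beta> \<gamma> p N U \<longleftrightarrow>
     (\<forall>k\<in>{1..N}. U k =
        max (p * ((\<alpha> + \<beta>) * (real k / real N) - \<beta>) + (1 - p) * continuation \<gamma> N U k)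
            (continuation \<gamma> N U k))
     \<and> U N = p * (\<alpha> + \<gamma>) - \<gamma>"

text \<open>The formula for the threshold is meaningful only if its base is nonnegative. If the numerator
  is negative, or if \<open>\<alpha> + \<beta> = 0\<close> (which forces the numerator to be nonpositive), offering to every
  candidate is optimal and the threshold is \<open>0\<close>. This has to be made explicit, since \<open>powr\<close> on a
  negative base would return an unrelated value.\<close>
definition t_star :: "real \<Rightarrow> real \<Rightarrow> real \<Rightarrow> real \<Rightarrow> real" where
  "t_star \<alpha> \<beta> \<gamma> p =
     (if p * \<alpha> + \<beta> - (1 - p) * \<gamma> \<le> 0 then 0
      else ((p * \<alpha> + \<beta> - (1 - p) * \<gamma>) / (\<alpha> + \<beta>)) powr (1 / (1 - p)))"

definition v :: "real \<Rightarrow> real \<Rightarrow> real \<Rightarrow> real \<Rightarrow> real \<Rightarrow> real" where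
  "v \<alpha> \<beta> \<gamma> p t =
     (\<alpha> * p + \<beta> - (1 - p) * \<gamma>) / (1 - p) * (t powr p - t) + \<beta> * t - \<beta>"

definition u :: "real \<Rightarrow> real \<Rightarrow> real \<Rightarrow> real \<Rightarrow> real \<Rightarrow> real" where
  "u \<alpha> \<beta> \<gamma> p t =
     (if t \<ge> t_star \<alpha> \<beta> \<gamma> p
      then p * ((\<alpha> + \<beta>) * t - \<beta>) + (1 - p) * (v \<alpha> \<beta> \<gamma> p t - \<gamma> * t)
      else (\<alpha> + \<beta>) * t_star \<alpha> \<beta> \<gamma> p - \<beta>)"

text \<open>The second closed form printed in the source for \<open>u\<close>. For \<open>t \<ge> t_star\<close> it equals
  \<open>v t - \<gamma> t\<close>, so it is the limit of the continuation value and not \<open>u\<close>: at \<open>t = 1\<close> it is \<open>- \<gamma>\<close>,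
  whereas \<open>u 1 = U N = p (\<alpha> + \<gamma>) - \<gamma>\<close>.\<close>
definition w :: "real \<Rightarrow> real \<Rightarrow> real \<Rightarrow> real \<Rightarrow> real \<Rightarrow> real" where
  "w \<alpha> \<beta> \<gamma> p t =
     (if t \<ge> t_star \<alpha> \<beta> \<gamma> p
      then (p * (\<alpha> + \<beta>) + (1 - p) * (\<beta> - \<gamma>)) / (1 - p) * (t powr p - t) + (\<beta> - \<gamma>) * t - \<beta>
      else (\<alpha> + \<beta>) * t_star \<alpha> \<beta> \<gamma> p - \<beta>)"

end

theory Submission
  imports Defs "HOL-Analysis.Analysis"
begin

text \<open>With \<open>R t = (\<alpha> + \<beta>) t - \<beta>\<close>, the continuation values \<open>c k\<close> satisfy
  \<open>c k = c (k + 1) + p / (k + 1) * max (R ((k + 1) / N) - c (k + 1)) 0\<close>, which is the backward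
  Euler scheme of step \<open>1 / N\<close> for \<open>y' = - (p / t) max (R t - y) 0\<close>, \<open>y 1 = - \<gamma>\<close>; the function \<open>w\<close>
  solves this equation. Because \<open>y \<mapsto> y + a max (r - y) 0\<close> is nonexpansive for \<open>a\<close> in \<open>[0, 1]\<close>,
  local errors only add up, so the scheme converges uniformly on \<open>[\<delta>, 1]\<close>. Finally
  \<open>U k = c k + p max (R (k / N) - c k) 0\<close>.\<close>

section \<open>Error propagation for the backward Euler scheme\<close>

lemma euler_step_nonexpansive:
  fixes a r x y :: real
  assumes "0 \<le> a" "a \<le> 1"
  shows "\<bar>(x + a * max (r - x) 0) - (y + a * max (r - y) 0)\<bar> \<le> \<bar>x - y\<bar>"
proof -
  \<comment> \<open>This exhibits the step as a convex combination of \<open>x\<close> and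
    \<open>max r x\<close>, each of which is 1-Lipschitz in \<open>x\<close>.\<close>
  have *: "x + a * max (r - x) 0 = (1 - a) * x + a * max r x" for x
    by (auto simp: max_def algebra_simps)
  have "(x + a * max (r - x) 0) - (y + a * max (r - y) 0)
      = (1 - a) * (x - y) + a * (max r x - max r y)"
    unfolding * by (simp add: algebra_simps)
  also have "\<bar>\<dots>\<bar> \<le> (1 - a) * \<bar>x - y\<bar> + a * \<bar>max r x - max r y\<bar>"
    using assms by (intro order.trans[OF abs_triangle_ineq]) (simp add: abs_mult)
  also have "\<dots> \<le> (1 - a) * \<bar>x - y\<bar> + a * \<bar>x - y\<bar>"
    using assms by (intro add_left_mono mult_left_mono) (auto simp: max_def)
  finally show ?thesis by (simp add: algebra_simps)
qed

text \<open>The coefficient \<open>p / t\<close> is singular at 0. On \<open>{\<delta>..1}\<close>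
  the right-hand side \<open>g\<close> along the solution is uniformly continuous, so for large
  \<open>N\<close> each step commits an error of at most \<open>\<epsilon> / N\<close>; there are
  fewer than \<open>N\<close> steps and none amplifies earlier errors.\<close>

lemma euler_backward_converges:
  fixes c :: "nat \<Rightarrow> nat \<Rightarrow> real" and y R :: "real \<Rightarrow> real"
  assumes p: "0 \<le> p" "p \<le> 1"
    and R: "continuous_on {0<..} R"
    and y: "\<And>t. t > 0 \<Longrightarrow> (y has_real_derivative - (p / t * max (R t - y t) 0)) (at t)"
    and c_N: "\<And>N. N \<ge> 1 \<Longrightarrow> c N N = y 1"
    and c_step: "\<And>N k. 1 \<le> k \<Longrightarrow> k < N \<Longrightarrow>
      c N k = c N (Suc k) + p / real (Suc k) * max (R (real (Suc k) / real N) - c N (Suc k)) 0"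
    and "\<delta> > 0" "\<epsilon> > 0"
  shows "\<forall>\<^sub>F N in sequentially.
    \<forall>k\<in>{1..N}. \<delta> \<le> real k / real N \<longrightarrow> \<bar>c N k - y (real k / real N)\<bar> \<le> \<epsilon>"
proof -
  define g where "g t = p / t * max (R t - y t) 0" for t
  have "continuous_on {0<..} y"
    using y by (intro continuous_at_imp_continuous_on ballI) (auto intro: DERIV_isCont)
  then have "continuous_on {0<..} g"
    unfolding g_def using R by (intro continuous_intros) auto
  then have "continuous_on {\<delta>..1} g"
    by (rule continuous_on_subset) (use \<open>\<delta> > 0\<close> in auto)
  then have "uniformly_continuous_on {\<delta>..1} g"
    by (intro compact_uniformly_continuous) auto
  then obtain d where "d > 0"
    and d: "\<And>s t. s \<in> {\<delta>..1} \<Longrightarrow> t \<in> {\<delta>..1} \<Longrightarrow> dist s t < d \<Longrightarrow> dist (g s) (g t) < \<epsilon>"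
    unfolding uniformly_continuous_on_def using \<open>\<epsilon> > 0\<close> by metis
  obtain N0 :: nat where N0: "1 / d < real N0"
    using reals_Archimedean2 by blast
  \<comment> \<open>Downward induction from \<open>k = N\<close>, where the error is 0; the bound
    counts the \<open>N - k\<close> steps made so far. The premise on \<delta> is kept inside the
    induction because it passes from \<open>k\<close> to \<open>k + 1\<close>.\<close>
  have main: "\<delta> \<le> real k / real N \<longrightarrow>
      \<bar>c N k - y (real k / real N)\<bar> \<le> \<epsilon> * (real (N - k) / real N)"
    if N: "N \<ge> N0" "N \<ge> 1" and k: "1 \<le> k" "k \<le> N" for N k
    using k(2,1)
  proof (induction k rule: inc_induct)
    case base
    then show ?case using c_N N by simp
  next
    case (step k)
    show ?case
    proof
      assume \<delta>: "\<delta> \<le> real k / real N"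
      define s t where "s = real k / real N" and "t = real (Suc k) / real N"
      have "N > 0" using N by simp
      have st: "s < t" "t - s = 1 / real N" "\<delta> \<le> s" "t \<le> 1"
        using \<open>N > 0\<close> \<delta> step.hyps by (auto simp: s_def t_def field_simps)
      have "\<delta> \<le> t" using st by simp
      then have IH: "\<bar>c N (Suc k) - y t\<bar> \<le> \<epsilon> * (real (N - Suc k) / real N)"
        using step.IH by (simp add: t_def)
      \<comment> \<open>The exact increment uses the slope at some \<open>z\<close> between the grid
        points, the scheme uses the slope at \<open>t\<close>; hence \<open>g t - g z\<close>
        measures the local error.\<close>
      have "\<exists>z. z > s \<and> z < t \<and> y t - y s = (t - s) * (- g z)"
        using st \<open>\<delta> > 0\<close> y unfolding g_def by (intro MVT2) auto
      then obtain z where z: "s < z" "z < t" "y t - y s = (t - s) * (- g z)" by blast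
      have "1 / real N < d"
        using order.strict_trans2[OF N0, of "real N"] N \<open>N > 0\<close> \<open>d > 0\<close>
        by (simp add: field_simps)
      then have "dist (g t) (g z) < \<epsilon>"
        using st z by (intro d) (auto simp: dist_real_def)
      then have "\<bar>g t - g z\<bar> / real N \<le> \<epsilon> / real N"
        by (intro divide_right_mono) (auto simp: dist_real_def)
      have "p / real (Suc k) = 1 / real N * (p / t)"
        using \<open>N > 0\<close> by (simp add: t_def)
      then have yt: "p / real (Suc k) * max (R t - y t) 0 = 1 / real N * g t"
        unfolding g_def by (simp only: mult.assoc)
      have "y s = y t + p / real (Suc k) * max (R t - y t) 0 - (g t - g z) / real N"
        using z(3) unfolding yt st(2) by (simp add: diff_divide_distrib)
      then have "c N k - y s = ((c N (Suc k) + p / real (Suc k) * max (R t - c N (Suc k)) 0)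
          - (y t + p / real (Suc k) * max (R t - y t) 0)) + (g t - g z) / real N"
        using c_step[OF step.prems step.hyps(2)] by (simp add: t_def)
      also have "\<bar>\<dots>\<bar> \<le> \<bar>c N (Suc k) - y t\<bar> + \<bar>g t - g z\<bar> / real N"
        using euler_step_nonexpansive[of "p / real (Suc k)" "c N (Suc k)" "R t" "y t"] p
        by (intro order.trans[OF abs_triangle_ineq] add_mono) auto
      also have "\<dots> \<le> \<epsilon> * (real (N - Suc k) / real N) + \<epsilon> / real N"
        using IH \<open>\<bar>g t - g z\<bar> / real N \<le> \<epsilon> / real N\<close> by simp
      also have "\<dots> = \<epsilon> * (real (N - k) / real N)"
        using step.hyps by (simp add: of_nat_diff field_simps)
      finally show "\<bar>c N k - y (real k / real N)\<bar> \<le> \<epsilon> * (real (N - k) / real N)"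
        by (simp add: s_def)
    qed
  qed
  have "\<bar>c N k - y (real k / real N)\<bar> \<le> \<epsilon>"
    if "N \<ge> max N0 1" "k \<in> {1..N}" "\<delta> \<le> real k / real N" for N k
  proof -
    have "\<epsilon> * (real (N - k) / real N) \<le> \<epsilon> * 1"
      using that \<open>\<epsilon> > 0\<close> by (intro mult_left_mono) auto
    then show ?thesis using main[of N k] that by force
  qed
  then show ?thesis
    unfolding eventually_sequentially by blast
qed

section \<open>The dynamic programming equation as a one-step recursion\<close>

lemma continuation_last:
  "N \<ge> 1 \<Longrightarrow> continuation \<gamma> N U N = - \<gamma>"
  by (simp add: continuation_def)

text \<open>All terms of the continuation value carry the factor \<open>k\<close>, so passing from
  \<open>k + 1\<close> to \<open>k\<close> rescales by \<open>k / (k + 1)\<close> and adds the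
  single new term \<open>U (k + 1) / (k + 1)\<close>. Here \<open>1 / (k + 1)\<close> is the
  probability that applicant \<open>k + 1\<close> is a candidate.\<close>

lemma continuation_step:
  assumes "1 \<le> k" "k < N"
  shows "continuation \<gamma> N U k
    = continuation \<gamma> N U (Suc k) + (U (Suc k) - continuation \<gamma> N U (Suc k)) / real (Suc k)"
proof -
  define S where "S = (\<Sum>j=Suc (Suc k)..N. U j / (real j * (real j - 1)))"
  have sum: "continuation \<gamma> N U i
      = real i * (\<Sum>j=Suc i..N. U j / (real j * (real j - 1))) - \<gamma> * (real i / real N)" for i
    by (simp add: continuation_def sum_distrib_left)
  have "(\<Sum>j=Suc k..N. U j / (real j * (real j - 1))) = U (Suc k) / (real (Suc k) * real k) + S"
    using assms by (subst sum.atLeast_Suc_atMost) (auto simp: S_def)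
  then have k: "continuation \<gamma> N U k
      = real k * (U (Suc k) / (real (Suc k) * real k) + S) - \<gamma> * (real k / real N)"
    by (simp only: sum)
  have Suc_k: "continuation \<gamma> N U (Suc k) = real (Suc k) * S - \<gamma> * (real (Suc k) / real N)"
    by (simp only: sum S_def)
  show ?thesis
    unfolding k Suc_k using assms by (simp add: divide_simps) (simp add: algebra_simps)
qed

text \<open>The two branches of the maximum differ by \<open>p\<close> times the reward minus the
  continuation value. Inserted into \<open>continuation_step\<close>, this yields a recursion for
  the continuation values alone.\<close>

lemma dp_solution_eq:
  assumes "dp_solution \<alpha> \<beta> \<gamma> p N U" "k \<in> {1..N}" "0 \<le> p"
  shows "U k = continuation \<gamma> N U k
    + p * max (((\<alpha> + \<beta>) * (real k / real N) - \<beta>) - continuation \<gamma> N U k) 0"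
proof -
  have *: "max (p * r + (1 - p) * c) c = c + p * max (r - c) 0" for r c :: real
  proof -
    have "p * max (r - c) 0 = max (p * (r - c)) 0"
      using \<open>0 \<le> p\<close> by (simp add: max_mult_distrib_left)
    then show ?thesis by (simp add: max_def algebra_simps)
  qed
  have "U k = max (p * ((\<alpha> + \<beta>) * (real k / real N) - \<beta>) + (1 - p) * continuation \<gamma> N U k)
            (continuation \<gamma> N U k)"
    using assms unfolding dp_solution_def by blast
  then show ?thesis unfolding * .
qed

section \<open>The explicit solution of the limit equation\<close>

context
  fixes \<alpha> \<beta> \<gamma> p A :: real
  assumes nonneg: "0 \<le> \<alpha>" "0 \<le> \<beta>" "0 \<le> \<gamma>" and p: "0 \<le> p" "p < 1"
  defines "A \<equiv> p * \<alpha> + \<beta> - (1 - p) * \<gamma>"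
begin

text \<open>The gap is \<open>(1 - p) * (\<alpha> + \<gamma>)\<close>. The bound keeps the base of
  the threshold at most 1 and gives \<open>\<alpha> + \<beta> > 0\<close> whenever
  \<open>A > 0\<close>.\<close>

lemma A_le: "A \<le> \<alpha> + \<beta>"
proof -
  have "0 \<le> (1 - p) * (\<alpha> + \<gamma>)" using nonneg p by simp
  then show ?thesis by (simp add: A_def algebra_simps)
qed

lemma t_star_le_1: "t_star \<alpha> \<beta> \<gamma> p \<le> 1"
proof -
  have "(A / (\<alpha> + \<beta>)) powr (1 / (1 - p)) \<le> 1" if "0 < A"
    using that A_le p by (intro powr_le1) auto
  then show ?thesis by (auto simp: t_star_def A_def)
qed

text \<open>Positivity excludes the default threshold 0, for which the left side is 0 while
  \<open>A\<close> may be negative.\<close>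

lemma t_star_powr:
  assumes "0 < t_star \<alpha> \<beta> \<gamma> p"
  shows "(\<alpha> + \<beta>) * t_star \<alpha> \<beta> \<gamma> p powr (1 - p) = A"
proof -
  have "0 < A" using assms by (auto simp: t_star_def A_def split: if_splits)
  then have "t_star \<alpha> \<beta> \<gamma> p = (A / (\<alpha> + \<beta>)) powr (1 / (1 - p))"
    by (simp add: t_star_def A_def)
  then show ?thesis using \<open>0 < A\<close> A_le p by (simp add: powr_powr)
qed

lemma le_powr_if_t_star_le:
  assumes "t_star \<alpha> \<beta> \<gamma> p \<le> t"
  shows "A \<le> (\<alpha> + \<beta>) * t powr (1 - p)"
proof (cases "0 < t_star \<alpha> \<beta> \<gamma> p")
  case True
  have "(\<alpha> + \<beta>) * t_star \<alpha> \<beta> \<gamma> p powr (1 - p) \<le> (\<alpha> + \<beta>) * t powr (1 - p)"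
    using True assms nonneg p by (intro mult_left_mono powr_mono2) auto
  then show ?thesis using t_star_powr[OF True] by simp
next
  case False
  \<comment> \<open>If \<open>A\<close> were positive, so would be the base of the threshold, and
    with it the threshold.\<close>
  then have "A \<le> 0"
    using A_le by (auto simp: t_star_def A_def split: if_splits)
  then show ?thesis using nonneg by (smt (verit) mult_nonneg_nonneg powr_ge_zero)
qed

text \<open>Solution of the linear equation \<open>y' = - (p / t) (R t - y)\<close>,
  \<open>y 1 = - \<gamma>\<close>, obtained by dropping the maximum: the regime in which every
  candidate receives an offer.\<close>

definition offer_sol :: "real \<Rightarrow> real" where
  "offer_sol t = A / (1 - p) * (t powr p - t) + (\<beta> - \<gamma>) * t - \<beta>"

lemma w_eq:
  "w \<alpha> \<beta> \<gamma> p t = (if t \<ge> t_star \<alpha> \<beta> \<gamma> p then offer_sol t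
    else (\<alpha> + \<beta>) * t_star \<alpha> \<beta> \<gamma> p - \<beta>)"
proof -
  have "p * (\<alpha> + \<beta>) + (1 - p) * (\<beta> - \<gamma>) = A" by (simp add: A_def algebra_simps)
  then show ?thesis by (simp add: w_def offer_sol_def)
qed

text \<open>The factorization reduces the sign of the difference to that of
  \<open>(\<alpha> + \<beta>) * t powr (1 - p) - A\<close>, which vanishes at a positive
  threshold.\<close>

lemma reward_minus_offer_sol:
  assumes "t > 0"
  shows "((\<alpha> + \<beta>) * t - \<beta>) - offer_sol t
    = t powr p / (1 - p) * ((\<alpha> + \<beta>) * t powr (1 - p) - A)"
proof -
  have "t powr p * t powr (1 - p) = t"
    using assms by (simp flip: powr_add)
  then have "t powr p / (1 - p) * ((\<alpha> + \<beta>) * t powr (1 - p) - A)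
      = ((\<alpha> + \<beta>) * t - A * t powr p) / (1 - p)"
    by (simp add: field_simps)
  also have "\<dots> = ((\<alpha> + \<beta>) * t - \<beta>) - offer_sol t"
    using p unfolding offer_sol_def by (simp add: divide_simps) (simp add: A_def algebra_simps)
  finally show ?thesis by simp
qed

lemma reward_ge_offer_sol:
  assumes "t > 0" "t_star \<alpha> \<beta> \<gamma> p \<le> t"
  shows "offer_sol t \<le> (\<alpha> + \<beta>) * t - \<beta>"
proof -
  have "0 \<le> ((\<alpha> + \<beta>) * t - \<beta>) - offer_sol t"
    unfolding reward_minus_offer_sol[OF assms(1)]
    using le_powr_if_t_star_le[OF assms(2)] p by simp
  then show ?thesis by simp
qed

lemma offer_sol_t_star:
  assumes "0 < t_star \<alpha> \<beta> \<gamma> p"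
  shows "offer_sol (t_star \<alpha> \<beta> \<gamma> p) = (\<alpha> + \<beta>) * t_star \<alpha> \<beta> \<gamma> p - \<beta>"
  using reward_minus_offer_sol[OF assms] t_star_powr[OF assms] by simp

lemma offer_sol_deriv:
  assumes "t > 0"
  shows "(offer_sol has_real_derivative
    - (p / t * (((\<alpha> + \<beta>) * t - \<beta>) - offer_sol t))) (at t)"
proof -
  have "t powr (p - 1) = t powr p / t"
    using assms by (simp add: powr_diff)
  then have "A / (1 - p) * (p * t powr (p - 1) - 1) + (\<beta> - \<gamma>)
      = - (p / t * (((\<alpha> + \<beta>) * t - \<beta>) - offer_sol t))"
    using assms p unfolding offer_sol_def
    by (simp add: divide_simps) (simp add: A_def algebra_simps)
  moreover have "(offer_sol has_real_derivative
      A / (1 - p) * (p * t powr (p - 1) - 1) + (\<beta> - \<gamma>)) (at t)"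
    unfolding offer_sol_def[abs_def] using assms p
    by (auto intro!: derivative_eq_intros simp: powr_diff)
  ultimately show ?thesis by simp
qed

text \<open>Above the threshold the reward dominates \<open>offer_sol\<close>, so the linear
  equation applies; below it the reward is at most the constant value of \<open>w\<close>, so the
  maximum is 0. At a positive threshold reward and \<open>offer_sol\<close> coincide, so the slope
  of \<open>offer_sol\<close> is 0 and the branches fit smoothly.\<close>

lemma w_deriv:
  assumes "t > 0"
  shows "(w \<alpha> \<beta> \<gamma> p has_real_derivative
    - (p / t * max (((\<alpha> + \<beta>) * t - \<beta>) - w \<alpha> \<beta> \<gamma> p t) 0)) (at t)"
proof -
  let ?s = "t_star \<alpha> \<beta> \<gamma> p"
  let ?D = "\<lambda>t. - (p / t * (((\<alpha> + \<beta>) * t - \<beta>) - offer_sol t))"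
  \<comment> \<open>The closures of the two half-lines meet only in \<open>?s\<close>, so the gluing
    rule asks for equal values and derivatives at that point alone.\<close>
  have cl: "{?s..} \<union> closure {?s..} \<inter> closure {..<?s} = {?s..}"
    by auto
  have "((\<lambda>t. if t \<in> {?s..} then offer_sol t else (\<alpha> + \<beta>) * ?s - \<beta>) has_vector_derivative
      (if t \<in> {?s..} then ?D t else 0)) (at t within UNIV)"
  proof (rule has_vector_derivative_If_within_closures
      [where S = "{?s..}" and T = "{..<?s}" and f' = ?D and g' = "\<lambda>_. 0"])
    show "(offer_sol has_vector_derivative ?D t)
        (at t within {?s..} \<union> closure {?s..} \<inter> closure {..<?s})"
      using offer_sol_deriv[OF assms] unfolding has_real_derivative_iff_has_vector_derivative
      by (rule has_vector_derivative_at_within)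
  qed (use assms offer_sol_t_star in \<open>auto simp: cl\<close>)
  moreover have "(\<lambda>t. if t \<in> {?s..} then offer_sol t else (\<alpha> + \<beta>) * ?s - \<beta>) = w \<alpha> \<beta> \<gamma> p"
    by (simp only: fun_eq_iff w_eq atLeast_iff simp_thms)
  ultimately have "(w \<alpha> \<beta> \<gamma> p has_real_derivative (if t \<ge> ?s then ?D t else 0)) (at t)"
    by (simp only: has_real_derivative_iff_has_vector_derivative atLeast_iff)
  moreover have "(\<alpha> + \<beta>) * t \<le> (\<alpha> + \<beta>) * ?s" if "t < ?s"
    using that nonneg by (intro mult_left_mono) auto
  ultimately show ?thesis
    using reward_ge_offer_sol[OF assms] by (auto simp: w_eq max_def split: if_splits)
qed

lemma w_1: "w \<alpha> \<beta> \<gamma> p 1 = - \<gamma>"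
  using t_star_le_1 by (simp add: w_eq offer_sol_def)

text \<open>Limit counterpart of \<open>dp_solution_eq\<close>: the same continuous map takes
  \<open>w\<close> to \<open>u\<close>, so convergence of the continuation values carries over to
  \<open>U\<close>.\<close>

lemma u_eq_w:
  assumes "t > 0"
  shows "u \<alpha> \<beta> \<gamma> p t
    = w \<alpha> \<beta> \<gamma> p t + p * max (((\<alpha> + \<beta>) * t - \<beta>) - w \<alpha> \<beta> \<gamma> p t) 0"
proof (cases "t_star \<alpha> \<beta> \<gamma> p \<le> t")
  case True
  have "v \<alpha> \<beta> \<gamma> p t - \<gamma> * t = offer_sol t"
    by (simp add: v_def offer_sol_def A_def algebra_simps)
  then show ?thesis
    using True reward_ge_offer_sol[OF assms True] by (simp add: u_def w_eq algebra_simps)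
next
  case False
  then have "(\<alpha> + \<beta>) * t \<le> (\<alpha> + \<beta>) * t_star \<alpha> \<beta> \<gamma> p"
    using nonneg by (intro mult_left_mono) auto
  then show ?thesis using False by (simp add: u_def w_eq)
qed

text \<open>The terms linear in \<open>t\<close> cancel, since
  \<open>p * (\<alpha> + \<beta>) + (1 - p) * (\<beta> - \<gamma>)\<close> is also the coefficient
  of \<open>t powr p - t\<close> after multiplication by \<open>1 - p\<close>.\<close>

lemma u_closed_form:
  "u \<alpha> \<beta> \<gamma> p t =
    (if t \<ge> t_star \<alpha> \<beta> \<gamma> p
     then (p * (\<alpha> + \<beta>) + (1 - p) * (\<beta> - \<gamma>)) * t powr p - \<beta>
     else (\<alpha> + \<beta>) * t_star \<alpha> \<beta> \<gamma> p - \<beta>)"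
  using p unfolding u_def v_def by (simp add: divide_simps) (simp add: algebra_simps)

section \<open>Passage to the limit\<close>

lemma dp_solution_limit:
  assumes U: "\<And>N. N \<ge> 1 \<Longrightarrow> dp_solution \<alpha> \<beta> \<gamma> p N (U N)"
    and "t > 0" and k: "\<And>N. N \<ge> 1 \<Longrightarrow> k N \<in> {1..N}"
    and lim: "(\<lambda>N. real (k N) / real N) \<longlonglongrightarrow> t"
  shows "(\<lambda>N. continuation \<gamma> N (U N) (k N)) \<longlonglongrightarrow> w \<alpha> \<beta> \<gamma> p t"
    and "(\<lambda>N. U N (k N)) \<longlonglongrightarrow> u \<alpha> \<beta> \<gamma> p t"
proof -
  let ?c = "\<lambda>N. continuation \<gamma> N (U N)"
  let ?w = "w \<alpha> \<beta> \<gamma> p"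
  define R where "R t = (\<alpha> + \<beta>) * t - \<beta>" for t
  \<comment> \<open>The cutoff \<open>t / 2\<close> stays away from 0 and is eventually exceeded by
    \<open>k N / N\<close>, which tends to \<open>t\<close>.\<close>
  have unif: "\<forall>\<^sub>F N in sequentially.
      \<forall>k\<in>{1..N}. t / 2 \<le> real k / real N \<longrightarrow> \<bar>?c N k - ?w (real k / real N)\<bar> \<le> \<epsilon>"
    if "\<epsilon> > 0" for \<epsilon>
  proof (rule euler_backward_converges[where p = p and R = R])
    show "continuous_on {0<..} R"
      unfolding R_def by (intro continuous_intros)
    show "?c N k = ?c N (Suc k)
        + p / real (Suc k) * max (R (real (Suc k) / real N) - ?c N (Suc k)) 0"
      if "1 \<le> k" "k < N" for N k
      using continuation_step[OF that, of \<gamma> "U N"] that p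
        dp_solution_eq[OF U, of N "Suc k"] by (simp add: R_def)
  qed (use p w_1 w_deriv continuation_last \<open>t > 0\<close> that in \<open>auto simp: R_def\<close>)
  have "\<forall>\<^sub>F N in sequentially. t / 2 < real (k N) / real N"
    using lim \<open>t > 0\<close> by (intro order_tendstoD) auto
  \<comment> \<open>The uniform estimate is taken at \<open>\<epsilon> / 2\<close> to turn its weak
    inequality into a strict one.\<close>
  then have "\<forall>\<^sub>F N in sequentially. dist (?c N (k N) - ?w (real (k N) / real N)) 0 < \<epsilon>"
    if "\<epsilon> > 0" for \<epsilon>
    using unif[OF half_gt_zero[OF that]] eventually_ge_at_top[of 1]
    by eventually_elim (use k that in \<open>force simp: dist_real_def\<close>)
  then have "(\<lambda>N. ?c N (k N) - ?w (real (k N) / real N)) \<longlonglongrightarrow> 0"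
    by (rule tendstoI)
  moreover have "(\<lambda>N. ?w (real (k N) / real N)) \<longlonglongrightarrow> ?w t"
    using DERIV_isCont[OF w_deriv[OF \<open>t > 0\<close>]] lim by (rule isCont_tendsto_compose)
  ultimately have "(\<lambda>N. ?c N (k N) - ?w (real (k N) / real N) + ?w (real (k N) / real N))
      \<longlonglongrightarrow> 0 + ?w t"
    by (rule tendsto_add)
  then show c: "(\<lambda>N. ?c N (k N)) \<longlonglongrightarrow> ?w t" by simp
  have "(\<lambda>N. ?c N (k N) + p * max (((\<alpha> + \<beta>) * (real (k N) / real N) - \<beta>) - ?c N (k N)) 0)
      \<longlonglongrightarrow> u \<alpha> \<beta> \<gamma> p t"
    unfolding u_eq_w[OF \<open>t > 0\<close>] by (intro tendsto_intros c lim)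
  moreover have "\<forall>\<^sub>F N in sequentially. U N (k N)
      = ?c N (k N) + p * max (((\<alpha> + \<beta>) * (real (k N) / real N) - \<beta>) - ?c N (k N)) 0"
    using eventually_ge_at_top[of 1]
    by eventually_elim (use U k p in \<open>blast intro: dp_solution_eq\<close>)
  ultimately show "(\<lambda>N. U N (k N)) \<longlonglongrightarrow> u \<alpha> \<beta> \<gamma> p t"
    by (simp add: tendsto_cong)
qed

end

theorem theorem2p5:
  fixes \<alpha> \<beta> \<gamma> p :: real and U :: "nat \<Rightarrow> nat \<Rightarrow> real"
  assumes "\<alpha> \<in> {0..1}" "\<beta> \<in> {0..1}" "\<gamma> \<in> {0..1}"
    and "0 \<le> p" "p < 1"
    and "\<And>N. N \<ge> 1 \<Longrightarrow> dp_solution \<alpha> \<beta> \<gamma> p N (U N)"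
  shows "\<forall>t\<in>{0<..1}.
      (\<forall>k :: nat \<Rightarrow> nat.
         (\<forall>N\<ge>1. k N \<in> {1..N}) \<and> (\<lambda>N. real (k N) / real N) \<longlonglongrightarrow> t \<longrightarrow>
         (\<lambda>N. U N (k N)) \<longlonglongrightarrow> u \<alpha> \<beta> \<gamma> p t \<and>
         (\<lambda>N. continuation \<gamma> N (U N) (k N)) \<longlonglongrightarrow> w \<alpha> \<beta> \<gamma> p t) \<and>
      u \<alpha> \<beta> \<gamma> p t =
        (if t \<ge> t_star \<alpha> \<beta> \<gamma> p
         then (p * (\<alpha> + \<beta>) + (1 - p) * (\<beta> - \<gamma>)) * t powr p - \<beta>
         else (\<alpha> + \<beta>) * t_star \<alpha> \<beta> \<gamma> p - \<beta>)"
proof (intro ballI conjI allI impI)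
  have *: "0 \<le> \<alpha>" "0 \<le> \<beta>" "0 \<le> \<gamma>" "0 \<le> p" "p < 1"
    using assms by auto
  fix t :: real assume "t \<in> {0<..1}"
  then have "t > 0" by simp
  show "u \<alpha> \<beta> \<gamma> p t =
        (if t \<ge> t_star \<alpha> \<beta> \<gamma> p
         then (p * (\<alpha> + \<beta>) + (1 - p) * (\<beta> - \<gamma>)) * t powr p - \<beta>
         else (\<alpha> + \<beta>) * t_star \<alpha> \<beta> \<gamma> p - \<beta>)"
    by (rule u_closed_form[OF *])
  fix k :: "nat \<Rightarrow> nat"
  assume k: "(\<forall>N\<ge>1. k N \<in> {1..N}) \<and> (\<lambda>N. real (k N) / real N) \<longlonglongrightarrow> t"
  show "(\<lambda>N. U N (k N)) \<longlonglongrightarrow> u \<alpha> \<beta> \<gamma> p t"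
    "(\<lambda>N. continuation \<gamma> N (U N) (k N)) \<longlonglongrightarrow> w \<alpha> \<beta> \<gamma> p t"
    using dp_solution_limit[OF * assms(6) \<open>t > 0\<close>, of k] k by auto
qed

end
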